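(* Let $\Gamma$ be a Carter diagram with the predefined numbering of vertices $\alpha_1,\alpha_2,\alpha_3,\beta_1$ in terms of which loctets are defined. Then: 1) Any linkage diagram containing a non-zero $\alpha$-label belongs to one of the loctets of the linkage system. 2) Any linkage diagram of a loctet uniquely determines the whole loctet. 3) If two loctets have one common linkage diagram, they coincide. 4) Every linkage diagram from the linkage system either belongs to one of the loctets or is $\beta$-unicolored.
   Context: Root systems are finite and simply-laced, with $(\alpha,\alpha)=2$ for every root. A simply-laced Carter diagram $\Gamma$ is a graph with solid/dotted edges, all of whose cycles have even length, realized by linearly independent (not necessarily simple) roots $\tau_1,\dots,\tau_l$ with $(\tau_i,\tau_j)=-1$ (solid), $+1$ (dotted), $0$ (no edge). Its vertices are split into an $\alpha$-set $\{\alpha_1,\dots,\alpha_k\}$ and a $\beta$-set $\{\beta_1,\dots,\beta_h\}$, each consisting of mutually orthogonal roots. $D_4(a_1)$ is the 4-cycle with an odd number of dotted edges; $\mathsf{C4}$ is the class of connected simply-laced Carter diagrams containing $D_4(a_1)$ as a subdiagram; $\mathsf{DE4}$ is the class of Dynkin diagrams $E_6,E_7,E_8,D_l$ ($l\ge4$), all edges solid. The diagrams $\Gamma$ considered are from $\mathsf{C4}$ or $\mathsf{DE4}$. Predefined numbering: for $\Gamma\in\mathsf{C4}$ with at least 5 vertices, $\Gamma$ contains $D_5(a_1)$ with vertices $\alpha_1,\alpha_2,\alpha_3,\beta_1,\beta_2$, where $\beta_1$ is joined by solid edges to $\alpha_1,\alpha_2,\alpha_3$, and $\beta_2$ is joined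 to $\alpha_2,\alpha_3$, exactly one of these last two edges being dotted; for $\Gamma\in\mathsf{DE4}$, $\beta_1$ is the branch point, joined to $\alpha_1,\alpha_2,\alpha_3$ by solid edges. A linkage labels vector (= linkage diagram) of $\Gamma$ is a nonzero vector $\gamma^{\vee}$ with coordinates $(\gamma,\tau)$, $\tau$ running over the vertices, where the vertices are realized by linearly independent roots with diagram $\Gamma$ in some root system $\varPhi$ and $\gamma\in\varPhi$ is a root not in the span $L$ of these roots. Write $a_i=(\gamma,\alpha_i)$, $b_i=(\gamma,\beta_i)$. An $\alpha$-label is any coordinate $a_1,\dots,a_k$ from the $\alpha$-set. A linkage diagram is $\beta$-unicolored if all its $\alpha$-labels are zero. The linkage system is the set of all linkage diagrams of $\Gamma$. Dual reflections act on $L^{\vee}=\mathbb{R}^l$ by $s^*_{\tau_i}u=u-u_i\,B_L\tau_i$, where $B_L=((\tau_i,\tau_j))$, $u_i$ is the $i$-th coordinate, and $B_L\tau_i$ is the $i$-th column of $B_L$. Loctets: let $\{i,j,k\}=\{1,2,3\}$, $i<j$. A loctet of type $L_{ij}$ is an 8-element set of linkage diagrams $\gamma^{\vee}_{ij}(1),\dots,\gamma^{\vee}_{ij}(8)$ whose coordinates $(a_i,a_j,a_k,b_1)$ are, respectively, $(0,0,-1,0)$, $(0,0,1,-1)$, $(-1,-1,0,1)$, $(-1,1,0,0)$, $(1,-1,0,0)$, $(1,1,0,-1)$, $(0,0,-1,1)$, $(0,0,1,0)$, and which are related (up to interchanging numbers 4 and 5) by $s^*_{\alpha_k}\gamma^{\vee}_{ij}(8)=\gamma^{\vee}_{ij}(7)$,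 $s^*_{\beta_1}\gamma^{\vee}_{ij}(7)=\gamma^{\vee}_{ij}(6)$, $s^*_{\alpha_i}\gamma^{\vee}_{ij}(6)=s^*_{\alpha_j}\gamma^{\vee}_{ij}(3)=\gamma^{\vee}_{ij}(4)$, $s^*_{\alpha_j}\gamma^{\vee}_{ij}(6)=s^*_{\alpha_i}\gamma^{\vee}_{ij}(3)=\gamma^{\vee}_{ij}(5)$, $s^*_{\beta_1}\gamma^{\vee}_{ij}(2)=\gamma^{\vee}_{ij}(3)$, $s^*_{\alpha_k}\gamma^{\vee}_{ij}(1)=\gamma^{\vee}_{ij}(2)$.
   Formalization: "α-label" (also in "β-unicolored") is restricted to a_1, a_2, a_3 instead of all a_1,…,a_k; with all of them, parts 1 and 4 fail for k ≥ 4, e.g. for D_6 with γ = e_1+e_7 in D_7, where only a_4 is non-zero. *)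

theory Defs
  imports "Jordan_Normal_Form.VS_Connect"
begin

section \<open>Simply-laced root systems\<close>

text \<open>
  A root system lives in some \<open>\<real>\<^sup>n\<close>, is normalised to \<open>(x,x) = 2\<close> and spans a possibly proper subspace
  of \<open>\<real>\<^sup>n\<close>. The norm condition excludes 0 and all multiples of a root other than its negative;
  irreducibility is not assumed.
\<close>

definition sl_root_system :: "nat \<Rightarrow> real vec set \<Rightarrow> bool" where
  "sl_root_system n \<Phi> \<longleftrightarrow>
     finite \<Phi> \<and> \<Phi> \<subseteq> carrier_vec n \<and>
     (\<forall>x\<in>\<Phi>. x \<bullet> x = 2) \<and>
     (\<forall>x\<in>\<Phi>. \<forall>y\<in>\<Phi>. y \<bullet> x \<in> \<int>) \<and>
     (\<forall>x\<in>\<Phi>. \<forall>y\<in>\<Phi>. y - (y \<bullet> x) \<cdot>\<^sub>v x \<in> \<Phi>)"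

abbreviation vec_span :: "nat \<Rightarrow> real vec set \<Rightarrow> real vec set" where
  "vec_span n \<equiv> LinearCombinations.module.span class_ring (module_vec TYPE(real) n)"

abbreviation vec_lin_dep :: "nat \<Rightarrow> real vec set \<Rightarrow> bool" where
  "vec_lin_dep n \<equiv> LinearCombinations.module.lin_dep class_ring (module_vec TYPE(real) n)"


section \<open>Graphs with solid and dotted edges\<close>

datatype bond = No_Edge | Solid | Dotted

text \<open>The vertices are \<open>0, \<dots>, size_of \<Gamma> - 1\<close>.\<close>

record diagram =
  size_of :: nat
  bond_of :: "nat \<Rightarrow> nat \<Rightarrow> bond"

definition diagram_wf :: "diagram \<Rightarrow> bool" where
  "diagram_wf \<Gamma> \<longleftrightarrow> (\<forall>i<size_of \<Gamma>. \<forall>j<size_of \<Gamma>. bond_of \<Gamma> i j = bond_of \<Gamma> j i) \<and>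
     (\<forall>i<size_of \<Gamma>. bond_of \<Gamma> i i = No_Edge)"

definition adj :: "diagram \<Rightarrow> nat \<Rightarrow> nat \<Rightarrow> bool" where
  "adj \<Gamma> i j \<longleftrightarrow> i < size_of \<Gamma> \<and> j < size_of \<Gamma> \<and> bond_of \<Gamma> i j \<noteq> No_Edge"

definition connected_diagram :: "diagram \<Rightarrow> bool" where
  "connected_diagram \<Gamma> \<longleftrightarrow> size_of \<Gamma> > 0 \<and>
     (\<forall>i<size_of \<Gamma>. \<forall>j<size_of \<Gamma>. (adj \<Gamma>)\<^sup>*\<^sup>* i j)"

definition cycle :: "diagram \<Rightarrow> nat list \<Rightarrow> bool" where
  "cycle \<Gamma> p \<longleftrightarrow> length p \<ge> 3 \<and> distinct p \<and>
     (\<forall>i<length p. adj \<Gamma> (p ! i) (p ! (Suc i mod length p)))"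

fun bond_value :: "bond \<Rightarrow> real" where
  "bond_value No_Edge = 0"
| "bond_value Solid = -1"
| "bond_value Dotted = 1"


section \<open>Carter diagrams\<close>

definition realizes ::
  "diagram \<Rightarrow> nat \<Rightarrow> real vec set \<Rightarrow> (nat \<Rightarrow> real vec) \<Rightarrow> bool" where
  "realizes \<Gamma> n \<Phi> \<tau> \<longleftrightarrow>
     sl_root_system n \<Phi> \<and>
     (\<forall>i<size_of \<Gamma>. \<tau> i \<in> \<Phi>) \<and>
     inj_on \<tau> {..<size_of \<Gamma>} \<and> \<not> vec_lin_dep n (\<tau> ` {..<size_of \<Gamma>}) \<and>
     (\<forall>i<size_of \<Gamma>. \<forall>j<size_of \<Gamma>. i \<noteq> j \<longrightarrow> \<tau> i \<bullet> \<tau> j = bond_value (bond_of \<Gamma> i j))"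

definition carter_diagram :: "diagram \<Rightarrow> bool" where
  "carter_diagram \<Gamma> \<longleftrightarrow> diagram_wf \<Gamma> \<and>
     (\<forall>p. cycle \<Gamma> p \<longrightarrow> even (length p)) \<and>
     (\<exists>n \<Phi> \<tau>. realizes \<Gamma> n \<Phi> \<tau>)"

text \<open>In a graph without odd cycles a 4-cycle has no diagonals, so none need be excluded here.\<close>

definition contains_D4a1 :: "diagram \<Rightarrow> bool" where
  "contains_D4a1 \<Gamma> \<longleftrightarrow> (\<exists>p. cycle \<Gamma> p \<and> length p = 4 \<and>
     odd (card {i. i < 4 \<and> bond_of \<Gamma> (p ! i) (p ! (Suc i mod 4)) = Dotted}))"

definition class_C4 :: "diagram \<Rightarrow> bool" where
  "class_C4 \<Gamma> \<longleftrightarrow> carter_diagram \<Gamma> \<and> connected_diagram \<Gamma> \<and> contains_D4a1 \<Gamma>"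

text \<open>
  A path \<open>0 - 1 - \<dots> - (l-2)\<close> with the remaining vertex \<open>l-1\<close> attached to the vertex \<open>c\<close> of the path:
  this is \<open>D\<^sub>l\<close> for \<open>c = l-3\<close>, and \<open>E\<^sub>l\<close> for \<open>c = 2\<close>.
\<close>

definition branched_path :: "nat \<Rightarrow> nat \<Rightarrow> diagram" where
  "branched_path l c = \<lparr> size_of = l, bond_of = (\<lambda>i j.
     if {i, j} \<in> insert {c, l - 1} {{m, Suc m} | m. Suc m < l - 1} then Solid else No_Edge) \<rparr>"

definition diagram_iso :: "diagram \<Rightarrow> diagram \<Rightarrow> bool" where
  "diagram_iso \<Gamma> \<Delta> \<longleftrightarrow> (\<exists>f. bij_betw f {..<size_of \<Gamma>} {..<size_of \<Delta>} \<and>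
     (\<forall>i<size_of \<Gamma>. \<forall>j<size_of \<Gamma>. bond_of \<Delta> (f i) (f j) = bond_of \<Gamma> i j))"

definition class_DE4 :: "diagram \<Rightarrow> bool" where
  "class_DE4 \<Gamma> \<longleftrightarrow> (\<exists>l\<in>{6, 7, 8}. diagram_iso \<Gamma> (branched_path l 2)) \<or>
     (\<exists>l\<ge>4. diagram_iso \<Gamma> (branched_path l (l - 3)))"


section \<open>Numbering of the vertices\<close>

text \<open>\<open>\<alpha> 1, \<dots>, \<alpha> k\<close> and \<open>\<beta> 1, \<dots>, \<beta> h\<close> are the vertices of the two parts.\<close>

definition alpha_beta_split ::
  "diagram \<Rightarrow> nat \<Rightarrow> nat \<Rightarrow> (nat \<Rightarrow> nat) \<Rightarrow> (nat \<Rightarrow> nat) \<Rightarrow> bool" where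
  "alpha_beta_split \<Gamma> k h \<alpha> \<beta> \<longleftrightarrow>
     inj_on \<alpha> {1..k} \<and> inj_on \<beta> {1..h} \<and>
     \<alpha> ` {1..k} \<inter> \<beta> ` {1..h} = {} \<and> \<alpha> ` {1..k} \<union> \<beta> ` {1..h} = {..<size_of \<Gamma>} \<and>
     (\<forall>i\<in>{1..k}. \<forall>j\<in>{1..k}. \<not> adj \<Gamma> (\<alpha> i) (\<alpha> j)) \<and>
     (\<forall>i\<in>{1..h}. \<forall>j\<in>{1..h}. \<not> adj \<Gamma> (\<beta> i) (\<beta> j))"

definition predefined_numbering ::
  "diagram \<Rightarrow> nat \<Rightarrow> nat \<Rightarrow> (nat \<Rightarrow> nat) \<Rightarrow> (nat \<Rightarrow> nat) \<Rightarrow> bool" where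
  "predefined_numbering \<Gamma> k h \<alpha> \<beta> \<longleftrightarrow>
     alpha_beta_split \<Gamma> k h \<alpha> \<beta> \<and> k \<ge> 3 \<and> h \<ge> 1 \<and>
     (\<forall>i\<in>{1, 2, 3}. bond_of \<Gamma> (\<beta> 1) (\<alpha> i) = Solid) \<and>
     (class_C4 \<Gamma> \<longrightarrow> h \<ge> 2 \<and>
        bond_of \<Gamma> (\<beta> 2) (\<alpha> 1) = No_Edge \<and>
        (bond_of \<Gamma> (\<beta> 2) (\<alpha> 2), bond_of \<Gamma> (\<beta> 2) (\<alpha> 3)) \<in> {(Solid, Dotted), (Dotted, Solid)})"


section \<open>Linkage systems and loctets\<close>

text \<open>\<open>realizes\<close> makes this the Gram matrix \<open>B\<^sub>L\<close> of every realization of \<open>\<Gamma>\<close>.\<close>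

definition gram :: "diagram \<Rightarrow> real mat" where
  "gram \<Gamma> = mat (size_of \<Gamma>) (size_of \<Gamma>)
     (\<lambda>(i, j). if i = j then 2 else bond_value (bond_of \<Gamma> i j))"

definition dual_refl :: "diagram \<Rightarrow> nat \<Rightarrow> real vec \<Rightarrow> real vec" where
  "dual_refl \<Gamma> i u = u - (u $ i) \<cdot>\<^sub>v col (gram \<Gamma>) i"

definition linkage_system :: "diagram \<Rightarrow> real vec set" where
  "linkage_system \<Gamma> = {v. v \<noteq> 0\<^sub>v (size_of \<Gamma>) \<and>
     (\<exists>n \<Phi> \<tau> \<gamma>. realizes \<Gamma> n \<Phi> \<tau> \<and> \<gamma> \<in> \<Phi> \<and> \<gamma> \<notin> vec_span n (\<tau> ` {..<size_of \<Gamma>}) \<and>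
        v = vec (size_of \<Gamma>) (\<lambda>i. \<gamma> \<bullet> \<tau> i))}"

text \<open>
  The \<open>\<alpha>\<close>-labels are the coordinates \<open>a\<^sub>1, a\<^sub>2, a\<^sub>3\<close> at the vertices in terms of which loctets are
  defined; for \<open>k = 3\<close> this is the whole \<open>\<alpha>\<close>-set. For \<open>k > 3\<close> the coordinates \<open>a\<^sub>4, \<dots>, a\<^sub>k\<close> must not be
  counted: in \<open>D\<^sub>6\<close> and \<open>E\<^sub>7\<close> (\<open>k = 4\<close>) there are linkage diagrams with \<open>a\<^sub>1 = a\<^sub>2 = a\<^sub>3 = 0\<close> and \<open>a\<^sub>4 \<noteq> 0\<close>, and they lie in no loctet.
\<close>

definition alpha_labels :: "(nat \<Rightarrow> nat) \<Rightarrow> real vec \<Rightarrow> real set" where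
  "alpha_labels \<alpha> v = {v $ \<alpha> i | i. i \<in> {1, 2, 3}}"

definition beta_unicolored :: "(nat \<Rightarrow> nat) \<Rightarrow> real vec \<Rightarrow> bool" where
  "beta_unicolored \<alpha> v \<longleftrightarrow> (\<forall>a\<in>alpha_labels \<alpha> v. a = 0)"

definition loctet_relations ::
  "diagram \<Rightarrow> (nat \<Rightarrow> nat) \<Rightarrow> (nat \<Rightarrow> nat) \<Rightarrow> nat \<Rightarrow> nat \<Rightarrow> nat \<Rightarrow> (nat \<Rightarrow> real vec) \<Rightarrow> bool" where
  "loctet_relations \<Gamma> \<alpha> \<beta> i j k g \<longleftrightarrow>
     dual_refl \<Gamma> (\<alpha> k) (g 8) = g 7 \<and>
     dual_refl \<Gamma> (\<beta> 1) (g 7) = g 6 \<and>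
     dual_refl \<Gamma> (\<alpha> i) (g 6) = g 4 \<and> dual_refl \<Gamma> (\<alpha> j) (g 3) = g 4 \<and>
     dual_refl \<Gamma> (\<alpha> j) (g 6) = g 5 \<and> dual_refl \<Gamma> (\<alpha> i) (g 3) = g 5 \<and>
     dual_refl \<Gamma> (\<beta> 1) (g 2) = g 3 \<and>
     dual_refl \<Gamma> (\<alpha> k) (g 1) = g 2"

text \<open>
  \<open>g 1, \<dots>, g 8\<close> are the linkage diagrams \<open>\<gamma>\<^sup>\<or>\<^bsub>ij\<^esub>(1), \<dots>, \<gamma>\<^sup>\<or>\<^bsub>ij\<^esub>(8)\<close>. The second alternative for the
  relations is the interchange of the numbers 4 and 5.
\<close>

definition loctet_family ::
  "diagram \<Rightarrow> (nat \<Rightarrow> nat) \<Rightarrow> (nat \<Rightarrow> nat) \<Rightarrow> nat \<Rightarrow> nat \<Rightarrow> nat \<Rightarrow> (nat \<Rightarrow> real vec) \<Rightarrow> bool" where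
  "loctet_family \<Gamma> \<alpha> \<beta> i j k g \<longleftrightarrow>
     (\<forall>m\<in>{1..8}. g m \<in> linkage_system \<Gamma>) \<and>
     map (\<lambda>m. (g m $ \<alpha> i, g m $ \<alpha> j, g m $ \<alpha> k, g m $ \<beta> 1)) [1, 2, 3, 4, 5, 6, 7, 8] =
       [(0, 0, -1, 0), (0, 0, 1, -1), (-1, -1, 0, 1), (-1, 1, 0, 0),
        (1, -1, 0, 0), (1, 1, 0, -1), (0, 0, -1, 1), (0, 0, 1, 0)] \<and>
     (loctet_relations \<Gamma> \<alpha> \<beta> i j k g \<or> loctet_relations \<Gamma> \<alpha> \<beta> i j k (g(4 := g 5, 5 := g 4)))"

definition loctet_of_type ::
  "diagram \<Rightarrow> (nat \<Rightarrow> nat) \<Rightarrow> (nat \<Rightarrow> nat) \<Rightarrow> nat \<Rightarrow> nat \<Rightarrow> real vec set \<Rightarrow> bool" where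
  "loctet_of_type \<Gamma> \<alpha> \<beta> i j S \<longleftrightarrow>
     (\<exists>k g. {i, j, k} = {1, 2, 3} \<and> i < j \<and> loctet_family \<Gamma> \<alpha> \<beta> i j k g \<and> S = g ` {1..8})"

definition loctet :: "diagram \<Rightarrow> (nat \<Rightarrow> nat) \<Rightarrow> (nat \<Rightarrow> nat) \<Rightarrow> real vec set \<Rightarrow> bool" where
  "loctet \<Gamma> \<alpha> \<beta> S \<longleftrightarrow> (\<exists>i j. loctet_of_type \<Gamma> \<alpha> \<beta> i j S)"

end

theory Submission
  imports Defs
begin

text \<open>
  Reflecting \<open>\<gamma>\<close> in \<open>\<tau>\<^sub>i\<close> keeps it a root outside \<open>L\<close>, so the linkage system is closed under the dual
  reflections, and by Cauchy--Schwarz all labels lie in \<open>{-1, 0, 1}\<close>. The vertices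
  \<open>\<alpha>\<^sub>1, \<alpha>\<^sub>2, \<alpha>\<^sub>3, \<beta>\<^sub>1\<close> span a \<open>D\<^sub>4\<close>, and the bound also holds for the pairing of \<open>\<gamma>\<close> with every root of
  this \<open>D\<^sub>4\<close>; hence its labels there are zero or one of the 24 weights of the three minuscule
  representations of \<open>D\<^sub>4\<close>. The orbit of each representation carries one type of loctet: the type is read
  off from which two of \<open>\<bar>a\<^sub>1\<bar>, \<bar>a\<^sub>2\<bar>, \<bar>a\<^sub>3\<bar>\<close> agree, the position from the labels, and since reflections are
  involutions any member determines the others.
\<close>

section \<open>Linkage systems and dual reflections\<close>

text \<open>The multiple of \<open>t\<close> lies in the span, so it can be subtracted and added
  back. This is what keeps a reflected root outside the span.\<close>

lemma minus_smult_in_span_iff: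
  assumes A: "A \<subseteq> carrier_vec n" and t: "t \<in> A" and g: "g \<in> carrier_vec n"
  shows "g - c \<cdot>\<^sub>v t \<in> vec_span n A \<longleftrightarrow> g \<in> vec_span n A"
proof -
  interpret vec_space "TYPE(real)" n .
  have sub: "submodule class_ring (span A) V"
    using A by (simp add: span_is_submodule)
  have tn: "t \<in> carrier_vec n" using A t by auto
  have ts: "d \<cdot>\<^sub>v t \<in> span A" for d
    using submodule.smult_closed[OF sub, of d t] span_mem[of A t] A t by (simp add: module_vec_simps)
  have add: "x + y \<in> span A" if "x \<in> span A" "y \<in> span A" for x y
    using submodule.m_closed[OF sub that] by (simp add: module_vec_simps)
  have "g - c \<cdot>\<^sub>v t = g + (- c) \<cdot>\<^sub>v t" "g = (g - c \<cdot>\<^sub>v t) + c \<cdot>\<^sub>v t"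
    using tn g by auto
  then show ?thesis using add ts by metis
qed

text \<open>Strict Cauchy-Schwarz: \<open>g - t\<close> and \<open>g + t\<close> are nonzero because
  \<open>g\<close> is outside the span, so their square norms \<open>4 - 2 * (g \<bullet> t)\<close>
  and \<open>4 + 2 * (g \<bullet> t)\<close> are positive. Integrality leaves three values.\<close>

lemma root_product_bound:
  assumes rs: "sl_root_system n \<Phi>" and g: "g \<in> \<Phi>" "g \<notin> vec_span n A"
    and A: "A \<subseteq> \<Phi>" and t: "t \<in> A"
  shows "g \<bullet> t \<in> {-1, 0, 1}"
proof -
  have car: "A \<subseteq> carrier_vec n" "g \<in> carrier_vec n" "t \<in> carrier_vec n" "t \<in> \<Phi>"
    using rs g A t by (auto simp: sl_root_system_def)
  have norm: "g \<bullet> g = 2" "t \<bullet> t = 2" "g \<bullet> t \<in> \<int>"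
    using rs g car by (auto simp: sl_root_system_def)
  have expand: "(g - c \<cdot>\<^sub>v t) \<bullet> (g - c \<cdot>\<^sub>v t) = 2 - 2 * c * (g \<bullet> t) + 2 * c\<^sup>2" for c
    using car norm comm_scalar_prod[of g n t]
    by (simp add: minus_scalar_prod_distrib[of _ n] scalar_prod_minus_distrib[of _ n] power2_eq_square
        algebra_simps)
  have zero: "0\<^sub>v n \<in> vec_span n A"
  proof -
    interpret vec_space "TYPE(real)" n .
    have "t \<in> span A" using car t by (simp add: span_mem)
    then show ?thesis using minus_smult_in_span_iff[OF car(1) t car(3), of 1] car by simp
  qed
  have pos: "0 < 2 - 2 * c * (g \<bullet> t) + 2 * c\<^sup>2" for c
  proof -
    have "g - c \<cdot>\<^sub>v t \<noteq> 0\<^sub>v n"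
      using minus_smult_in_span_iff[OF car(1) t car(2), of c] g zero by auto
    moreover have "g - c \<cdot>\<^sub>v t \<in> carrier_vec n" using car by auto
    ultimately have "(g - c \<cdot>\<^sub>v t) \<bullet> (g - c \<cdot>\<^sub>v t) \<noteq> 0"
      using conjugate_square_eq_0_vec[of "g - c \<cdot>\<^sub>v t" n] by simp
    moreover have "(g - c \<cdot>\<^sub>v t) \<bullet> (g - c \<cdot>\<^sub>v t) \<ge> 0"
      by (auto simp: scalar_prod_def intro!: sum_nonneg)
    ultimately show ?thesis using expand[of c] by simp
  qed
  obtain m :: int where m: "g \<bullet> t = of_int m" using norm(3) by (auto elim: Ints_cases)
  have "m < 2" "m > -2" using pos[of 1] pos[of "-1"] m by auto
  then have "m = -1 \<or> m = 0 \<or> m = 1" by arith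
  then show ?thesis using m by auto
qed

lemma dual_refl_index:
  assumes "i < size_of \<Gamma>" "j < size_of \<Gamma>"
  shows "dual_refl \<Gamma> i u $ j =
    u $ j - u $ i * (if i = j then 2 else bond_value (bond_of \<Gamma> j i))"
  using assms by (simp add: dual_refl_def gram_def)

lemma dual_refl_carrier [simp]: "dual_refl \<Gamma> i u \<in> carrier_vec (size_of \<Gamma>)"
  by (simp add: dual_refl_def gram_def carrier_vecI)

lemma dual_refl_dual_refl:
  assumes "u \<in> carrier_vec (size_of \<Gamma>)" "i < size_of \<Gamma>"
  shows "dual_refl \<Gamma> i (dual_refl \<Gamma> i u) = u"
  using assms by (intro eq_vecI) (auto simp: dual_refl_index carrier_vecD[OF dual_refl_carrier])

lemma dual_refl_commute:
  assumes "i < size_of \<Gamma>" "j < size_of \<Gamma>" "bond_of \<Gamma> i j = No_Edge" "bond_of \<Gamma> j i = No_Edge"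
  shows "dual_refl \<Gamma> i (dual_refl \<Gamma> j u) = dual_refl \<Gamma> j (dual_refl \<Gamma> i u)"
  using assms by (intro eq_vecI) (auto simp: dual_refl_index carrier_vecD[OF dual_refl_carrier])

lemma linkage_system_carrier: "v \<in> linkage_system \<Gamma> \<Longrightarrow> v \<in> carrier_vec (size_of \<Gamma>)"
  by (auto simp: linkage_system_def)

lemma linkage_system_index:
  assumes "v \<in> linkage_system \<Gamma>" "i < size_of \<Gamma>"
  shows "v $ i \<in> {-1, 0, 1}"
proof -
  obtain n \<Phi> \<tau> \<gamma> where r: "realizes \<Gamma> n \<Phi> \<tau>" and g: "\<gamma> \<in> \<Phi>" "\<gamma> \<notin> vec_span n (\<tau> ` {..<size_of \<Gamma>})"
    and v: "v = vec (size_of \<Gamma>) (\<lambda>i. \<gamma> \<bullet> \<tau> i)"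
    using assms(1) by (auto simp: linkage_system_def)
  have "\<gamma> \<bullet> \<tau> i \<in> {-1, 0, 1}"
    by (rule root_product_bound[OF _ g]) (use r assms(2) in \<open>auto simp: realizes_def\<close>)
  then show ?thesis using v assms(2) by simp
qed

text \<open>The reflected labels are those of the root \<open>\<gamma>\<close> reflected in
  \<open>\<tau> i\<close>, within the same realization.\<close>

lemma dual_refl_linkage_system:
  assumes v: "v \<in> linkage_system \<Gamma>" and i: "i < size_of \<Gamma>"
  shows "dual_refl \<Gamma> i v \<in> linkage_system \<Gamma>"
proof -
  let ?N = "size_of \<Gamma>"
  obtain n \<Phi> \<tau> \<gamma> where r: "realizes \<Gamma> n \<Phi> \<tau>" and g: "\<gamma> \<in> \<Phi>" "\<gamma> \<notin> vec_span n (\<tau> ` {..<?N})"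
    and v_def: "v = vec ?N (\<lambda>i. \<gamma> \<bullet> \<tau> i)" and v0: "v \<noteq> 0\<^sub>v ?N"
    using v by (auto simp: linkage_system_def)
  have \<tau>: "\<tau> j \<in> \<Phi>" if "j < ?N" for j using r that by (simp add: realizes_def)
  have rs: "sl_root_system n \<Phi>" using r by (simp add: realizes_def)
  have \<Phi>: "x \<in> carrier_vec n" if "x \<in> \<Phi>" for x using rs that by (auto simp: sl_root_system_def)
  define \<delta> where "\<delta> = \<gamma> - (\<gamma> \<bullet> \<tau> i) \<cdot>\<^sub>v \<tau> i"
  have "\<delta> \<in> \<Phi>" using rs g \<tau>[OF i] by (simp add: sl_root_system_def \<delta>_def)
  moreover have "\<delta> \<notin> vec_span n (\<tau> ` {..<?N})"
    unfolding \<delta>_def using minus_smult_in_span_iff[of "\<tau> ` {..<?N}" n "\<tau> i" \<gamma>] g \<tau> \<Phi> i by auto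
  moreover have "dual_refl \<Gamma> i v = vec ?N (\<lambda>j. \<delta> \<bullet> \<tau> j)"
  proof (intro eq_vecI)
    show "dim_vec (dual_refl \<Gamma> i v) = dim_vec (vec ?N (\<lambda>j. \<delta> \<bullet> \<tau> j))"
      by (simp add: carrier_vecD[OF dual_refl_carrier])
    fix j assume "j < dim_vec (vec ?N (\<lambda>j. \<delta> \<bullet> \<tau> j))"
    then have j: "j < ?N" by simp
    have "\<tau> i \<bullet> \<tau> j = (if i = j then 2 else bond_value (bond_of \<Gamma> j i))"
    proof (cases "i = j")
      case True
      then show ?thesis using rs \<tau>[OF j] by (simp add: sl_root_system_def)
    next
      case False
      then have "\<tau> j \<bullet> \<tau> i = bond_value (bond_of \<Gamma> j i)" using r i j by (simp add: realizes_def)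
      then show ?thesis using False comm_scalar_prod[OF \<Phi> \<Phi>, OF \<tau> \<tau>] i j by metis
    qed
    moreover have "\<delta> \<bullet> \<tau> j = \<gamma> \<bullet> \<tau> j - (\<gamma> \<bullet> \<tau> i) * (\<tau> i \<bullet> \<tau> j)"
      unfolding \<delta>_def using \<Phi>[OF g(1)] \<Phi>[OF \<tau>[OF i]] \<Phi>[OF \<tau>[OF j]]
      by (simp add: minus_scalar_prod_distrib[of _ n])
    ultimately show "dual_refl \<Gamma> i v $ j = vec ?N (\<lambda>j. \<delta> \<bullet> \<tau> j) $ j"
      using i j by (simp only: dual_refl_index v_def index_vec)
  qed
  \<comment> \<open>The reflection is an involution fixing 0, so a zero image would force
    \<open>v\<close> to be zero.\<close>
  moreover have "dual_refl \<Gamma> i v \<noteq> 0\<^sub>v ?N"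
  proof
    assume "dual_refl \<Gamma> i v = 0\<^sub>v ?N"
    then have "v = dual_refl \<Gamma> i (0\<^sub>v ?N)"
      using dual_refl_dual_refl[OF linkage_system_carrier[OF v] i] by simp
    also have "\<dots> = 0\<^sub>v ?N"
      using i by (intro eq_vecI) (auto simp: dual_refl_index carrier_vecD[OF dual_refl_carrier])
    finally show False using v0 by simp
  qed
  ultimately show ?thesis using r unfolding linkage_system_def by blast
qed


section \<open>The orbits of the Weyl group of a claw\<close>

text \<open>If \<open>g8\<close> has labels \<open>(0, 0, 1, 0)\<close>, the fundamental weight of
  the leaf \<open>r\<close>, this is its orbit under the Weyl group of the claw, in the order of the
  loctet numbering. For \<open>g3\<close>, \<open>g2\<close>, \<open>g1\<close> the loctet relations
  are read in reverse.\<close>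

definition octet :: "diagram \<Rightarrow> nat \<Rightarrow> nat \<Rightarrow> nat \<Rightarrow> nat \<Rightarrow> real vec \<Rightarrow> real vec list" where
  "octet \<Gamma> p q r c g8 =
     (let g7 = dual_refl \<Gamma> r g8; g6 = dual_refl \<Gamma> c g7; g5 = dual_refl \<Gamma> q g6;
          g4 = dual_refl \<Gamma> p g6; g3 = dual_refl \<Gamma> q g4; g2 = dual_refl \<Gamma> c g3; g1 = dual_refl \<Gamma> r g2
      in [g1, g2, g3, g4, g5, g6, g7, g8])"

text \<open>Inverts \<open>octet\<close>: the labels tell the position of \<open>v\<close>, and the reflections lead back to \<open>g8\<close>.\<close>

definition octet_top :: "diagram \<Rightarrow> nat \<Rightarrow> nat \<Rightarrow> nat \<Rightarrow> nat \<Rightarrow> real vec \<Rightarrow> real vec" where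
  "octet_top \<Gamma> p q r c v =
     (let s = dual_refl \<Gamma> in
      if v $ r = 1 then if v $ c = 0 then v else s r (s c (s p (s q (s c v))))
      else if v $ r = -1 then if v $ c = 1 then s r v else s r (s c (s p (s q (s c (s r v)))))
      else if v $ p = -1 then if v $ q = -1 then s r (s c (s p (s q v))) else s r (s c (s p v))
      else if v $ q = -1 then s r (s c (s q v)) else s r (s c v))"

text \<open>With \<open>w\<close> at the centre, the assumptions bound the pairings with all twelve
  positive roots of D4. A check of 81 tuples remains: in a nonzero survivor exactly one leaf label
  stands out in absolute value, and that leaf identifies the minuscule representation.\<close>

lemma D4_weight_cases:
  fixes x y z w :: real
  assumes "x \<in> {-1, 0, 1}" "y \<in> {-1, 0, 1}" "z \<in> {-1, 0, 1}" "w \<in> {-1, 0, 1}"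
    and "\<bar>w + x\<bar> \<le> 1" "\<bar>w + y\<bar> \<le> 1" "\<bar>w + z\<bar> \<le> 1"
    and "\<bar>w + x + y\<bar> \<le> 1" "\<bar>w + x + z\<bar> \<le> 1" "\<bar>w + y + z\<bar> \<le> 1"
    and "\<bar>w + x + y + z\<bar> \<le> 1" "\<bar>2 * w + x + y + z\<bar> \<le> 1"
  shows "\<bar>x\<bar> = \<bar>y\<bar> \<and> \<bar>z\<bar> \<noteq> \<bar>x\<bar> \<longrightarrow>
      (x, y, z, w) \<in> {(0, 0, -1, 0), (0, 0, 1, -1), (-1, -1, 0, 1), (-1, 1, 0, 0),
        (1, -1, 0, 0), (1, 1, 0, -1), (0, 0, -1, 1), (0, 0, 1, 0)}"
    and "\<bar>x\<bar> = \<bar>y\<bar> \<and> \<bar>z\<bar> \<noteq> \<bar>x\<bar> \<or> \<bar>x\<bar> = \<bar>z\<bar> \<and> \<bar>y\<bar> \<noteq> \<bar>x\<bar> \<or>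
      \<bar>y\<bar> = \<bar>z\<bar> \<and> \<bar>x\<bar> \<noteq> \<bar>y\<bar> \<or> x = 0 \<and> y = 0 \<and> z = 0"
  using assms apply -
  subgoal by (elim insertE emptyE) simp_all
  subgoal by (elim insertE emptyE) simp_all
  done

text \<open>A D4 with its leaves in free order: the three loctet types are one computation with
  \<open>p\<close>, \<open>q\<close>, \<open>r\<close> permuted.\<close>

locale claw =
  fixes \<Gamma> :: diagram and p q r c :: nat
  assumes wf: "diagram_wf \<Gamma>"
    and less: "p < size_of \<Gamma>" "q < size_of \<Gamma>" "r < size_of \<Gamma>" "c < size_of \<Gamma>"
    and leaves: "p \<noteq> q" "p \<noteq> r" "q \<noteq> r"
    and centre: "bond_of \<Gamma> c p = Solid" "bond_of \<Gamma> c q = Solid" "bond_of \<Gamma> c r = Solid"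
    and orth: "bond_of \<Gamma> p q = No_Edge" "bond_of \<Gamma> p r = No_Edge" "bond_of \<Gamma> q r = No_Edge"
begin

abbreviation s :: "nat \<Rightarrow> real vec \<Rightarrow> real vec" where "s \<equiv> dual_refl \<Gamma>"

abbreviation coords :: "real vec \<Rightarrow> real \<times> real \<times> real \<times> real" where
  "coords v \<equiv> (v $ p, v $ q, v $ r, v $ c)"

lemma bonds_sym:
  "bond_of \<Gamma> p c = Solid" "bond_of \<Gamma> q c = Solid" "bond_of \<Gamma> r c = Solid"
  "bond_of \<Gamma> q p = No_Edge" "bond_of \<Gamma> r p = No_Edge" "bond_of \<Gamma> r q = No_Edge"
  using wf less centre orth by (metis diagram_wf_def)+

lemma centre_noteq: "c \<noteq> p" "c \<noteq> q" "c \<noteq> r"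
  using wf less centre by (metis bond.distinct(1) diagram_wf_def)+

lemma refl_simps [simp]:
  "s p v $ p = - v $ p" "s p v $ q = v $ q" "s p v $ r = v $ r" "s p v $ c = v $ c + v $ p"
  "s q v $ p = v $ p" "s q v $ q = - v $ q" "s q v $ r = v $ r" "s q v $ c = v $ c + v $ q"
  "s r v $ p = v $ p" "s r v $ q = v $ q" "s r v $ r = - v $ r" "s r v $ c = v $ c + v $ r"
  "s c v $ p = v $ p + v $ c" "s c v $ q = v $ q + v $ c" "s c v $ r = v $ r + v $ c"
  "s c v $ c = - v $ c"
  using less leaves leaves[symmetric] centre orth bonds_sym centre_noteq centre_noteq[symmetric]
  by (simp_all add: dual_refl_index)

lemma refl_refl [simp]:
  assumes "v \<in> carrier_vec (size_of \<Gamma>)"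
  shows "s p (s p v) = v" "s q (s q v) = v" "s r (s r v) = v" "s c (s c v) = v"
  using assms less by (simp_all add: dual_refl_dual_refl)

text \<open>Orthogonal leaves commute. In \<open>octet\<close>, number 3 is reached through number
  4; this rule also ties it to number 5, as the loctet relations demand.\<close>

lemma refl_pqp [simp]:
  assumes "v \<in> carrier_vec (size_of \<Gamma>)"
  shows "s p (s q (s p v)) = s q v"
  using assms dual_refl_commute[OF less(1,2) orth(1) bonds_sym(4)] by simp

lemma linkage_simps [simp]:
  assumes "v \<in> linkage_system \<Gamma>"
  shows "s p v \<in> linkage_system \<Gamma>" "s q v \<in> linkage_system \<Gamma>" "s r v \<in> linkage_system \<Gamma>"
    "s c v \<in> linkage_system \<Gamma>" "v \<in> carrier_vec (size_of \<Gamma>)"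
  using assms less by (simp_all add: dual_refl_linkage_system linkage_system_carrier)

lemma linkage_coords:
  assumes v: "v \<in> linkage_system \<Gamma>"
  shows "v $ p \<in> {-1, 0, 1}" "v $ q \<in> {-1, 0, 1}" "v $ r \<in> {-1, 0, 1}" "v $ c \<in> {-1, 0, 1}"
  using assms less by (simp_all only: linkage_system_index)

text \<open>The pairings with the positive roots of the subsystem \<open>D\<^sub>4\<close> that are not simple.\<close>

lemma linkage_bounds:
  assumes v: "v \<in> linkage_system \<Gamma>"
  shows "\<bar>v $ c + v $ p\<bar> \<le> 1" "\<bar>v $ c + v $ q\<bar> \<le> 1" "\<bar>v $ c + v $ r\<bar> \<le> 1"
    "\<bar>v $ c + v $ p + v $ q\<bar> \<le> 1" "\<bar>v $ c + v $ p + v $ r\<bar> \<le> 1" "\<bar>v $ c + v $ q + v $ r\<bar> \<le> 1"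
    "\<bar>v $ c + v $ p + v $ q + v $ r\<bar> \<le> 1" "\<bar>2 * v $ c + v $ p + v $ q + v $ r\<bar> \<le> 1"
proof -
  \<comment> \<open>Each of these roots is an image of the simple root at \<open>c\<close>, so the
    pairing with it is the \<open>c\<close> label of a reflected linkage diagram.\<close>
  have bound: "\<bar>u $ c\<bar> \<le> 1" if "u \<in> linkage_system \<Gamma>" for u
    using linkage_coords(4)[OF that] by auto
  show "\<bar>v $ c + v $ p\<bar> \<le> 1" "\<bar>v $ c + v $ q\<bar> \<le> 1" "\<bar>v $ c + v $ r\<bar> \<le> 1"
    using bound[of "s p v"] bound[of "s q v"] bound[of "s r v"] v by simp_all
  show "\<bar>v $ c + v $ p + v $ q\<bar> \<le> 1" "\<bar>v $ c + v $ p + v $ r\<bar> \<le> 1"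
    "\<bar>v $ c + v $ q + v $ r\<bar> \<le> 1"
    using bound[of "s q (s p v)"] bound[of "s r (s p v)"] bound[of "s r (s q v)"] v by simp_all
  show "\<bar>v $ c + v $ p + v $ q + v $ r\<bar> \<le> 1"
    using bound[of "s r (s q (s p v))"] v by simp
  \<comment> \<open>For the highest root, reflecting in \<open>c\<close> first adds the centre label
    to each of the three leaves.\<close>
  have "s r (s q (s p (s c v))) $ c = 2 * v $ c + v $ p + v $ q + v $ r" by simp
  then show "\<bar>2 * v $ c + v $ p + v $ q + v $ r\<bar> \<le> 1"
    using bound[of "s r (s q (s p (s c v)))"] v by simp
qed

lemma coords_cases:
  assumes v: "v \<in> linkage_system \<Gamma>" and "\<bar>v $ p\<bar> = \<bar>v $ q\<bar>" "\<bar>v $ r\<bar> \<noteq> \<bar>v $ p\<bar>"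
  shows "coords v \<in> {(0, 0, -1, 0), (0, 0, 1, -1), (-1, -1, 0, 1), (-1, 1, 0, 0),
        (1, -1, 0, 0), (1, 1, 0, -1), (0, 0, -1, 1), (0, 0, 1, 0)}"
  by (rule D4_weight_cases(1)[OF linkage_coords[OF v] linkage_bounds[OF v], THEN mp]) (intro conjI assms)

lemma type_cases:
  assumes v: "v \<in> linkage_system \<Gamma>" and "v $ p \<noteq> 0 \<or> v $ q \<noteq> 0 \<or> v $ r \<noteq> 0"
  shows "\<bar>v $ p\<bar> = \<bar>v $ q\<bar> \<and> \<bar>v $ r\<bar> \<noteq> \<bar>v $ p\<bar> \<or> \<bar>v $ p\<bar> = \<bar>v $ r\<bar> \<and> \<bar>v $ q\<bar> \<noteq> \<bar>v $ p\<bar> \<or>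
    \<bar>v $ q\<bar> = \<bar>v $ r\<bar> \<and> \<bar>v $ p\<bar> \<noteq> \<bar>v $ q\<bar>"
  using D4_weight_cases(2)[OF linkage_coords[OF v] linkage_bounds[OF v]] assms(2) by argo

text \<open>Makes the type an invariant of the octet, so octets of different types cannot
  meet.\<close>

lemma octet_type:
  assumes "coords u = (0, 0, 1, 0)" "v \<in> set (octet \<Gamma> p q r c u)"
  shows "\<bar>v $ p\<bar> = \<bar>v $ q\<bar>" "\<bar>v $ r\<bar> \<noteq> \<bar>v $ p\<bar>"
  using assms by (auto simp: octet_def Let_def)

text \<open>In each of the eight positions the labels select the right branch and the reflections
  cancel in pairs.\<close>

lemma octet_top_octet:
  assumes "u \<in> carrier_vec (size_of \<Gamma>)" "coords u = (0, 0, 1, 0)" "v \<in> set (octet \<Gamma> p q r c u)"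
  shows "octet_top \<Gamma> p q r c v = u"
  using assms by (auto simp: octet_def octet_top_def Let_def)

text \<open>The existence half: \<open>coords_cases\<close> leaves eight label tuples, and for each
  the word chosen by \<open>octet_top\<close> is undone on the way down through
  \<open>octet\<close>.\<close>

lemma octet_top_works:
  assumes v: "v \<in> linkage_system \<Gamma>" and "\<bar>v $ p\<bar> = \<bar>v $ q\<bar>" "\<bar>v $ r\<bar> \<noteq> \<bar>v $ p\<bar>"
  defines "u \<equiv> octet_top \<Gamma> p q r c v"
  shows "u \<in> linkage_system \<Gamma>" "coords u = (0, 0, 1, 0)" "v \<in> set (octet \<Gamma> p q r c u)"
  using coords_cases[OF assms(1-3)] v
  by (auto simp: u_def octet_def octet_top_def Let_def)

end


section \<open>Loctets are octets\<close>

lemma atLeastAtMost_1_8: "{1..8::nat} = {1, 2, 3, 4, 5, 6, 7, 8}"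
  by auto

text \<open>The relations generate the whole family from \<open>g 8\<close>.\<close>

lemma loctet_family_octet:
  assumes cl: "claw \<Gamma> (\<alpha> i) (\<alpha> j) (\<alpha> k) (\<beta> 1)" and fam: "loctet_family \<Gamma> \<alpha> \<beta> i j k g"
  shows "g ` {1..8} = set (octet \<Gamma> (\<alpha> i) (\<alpha> j) (\<alpha> k) (\<beta> 1) (g 8))" (is "_ = set (?O (g 8))")
    and "g 8 \<in> linkage_system \<Gamma>"
    and "(g 8 $ \<alpha> i, g 8 $ \<alpha> j, g 8 $ \<alpha> k, g 8 $ \<beta> 1) = (0, 0, 1, 0)"
proof -
  interpret claw \<Gamma> "\<alpha> i" "\<alpha> j" "\<alpha> k" "\<beta> 1" by (rule cl)
  have L: "g m \<in> linkage_system \<Gamma>" if "m \<in> {1..8}" for m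
    using fam that by (simp add: loctet_family_def)
  show "g 8 \<in> linkage_system \<Gamma>" using L by simp
  show "coords (g 8) = (0, 0, 1, 0)" using fam by (simp add: loctet_family_def)
  \<comment> \<open>The prescribed labels exclude the interchange of 4 and 5: it would make
    \<open>g 5\<close> the reflection of \<open>g 6\<close> in \<open>\<alpha> i\<close>, which
    flips the sign of that label.\<close>
  have "g 5 $ \<alpha> i = 1" "g 6 $ \<alpha> i = 1"
    using fam by (simp_all add: loctet_family_def)
  then have "s (\<alpha> i) (g 6) \<noteq> g 5" by (metis refl_simps(1) one_neq_neg_one)
  then have "\<not> loctet_relations \<Gamma> \<alpha> \<beta> i j k (g(4 := g 5, 5 := g 4))"
    by (simp add: loctet_relations_def)
  then have "loctet_relations \<Gamma> \<alpha> \<beta> i j k g" using fam by (simp add: loctet_family_def)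
  note R = this[unfolded loctet_relations_def]
  \<comment> \<open>These relations point upwards from \<open>g 1\<close>; involutivity turns them
    into the direction used by \<open>octet\<close>.\<close>
  have "s (\<alpha> j) (g 4) = g 3" "s (\<beta> 1) (g 3) = g 2" "s (\<alpha> k) (g 2) = g 1"
    using R refl_refl(2)[OF linkage_simps(5)[OF L[of 3]]] refl_refl(4)[OF linkage_simps(5)[OF L[of 2]]]
      refl_refl(3)[OF linkage_simps(5)[OF L[of 1]]] by simp_all
  then have "?O (g 8) = [g 1, g 2, g 3, g 4, g 5, g 6, g 7, g 8]"
    using R by (simp add: octet_def Let_def)
  then show "g ` {1..8} = set (?O (g 8))"
    unfolding atLeastAtMost_1_8 by simp
qed

text \<open>The converse construction; \<open>m - 1\<close> converts the numbering from 1 into list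
  positions from 0.\<close>

lemma octet_loctet_family:
  assumes cl: "claw \<Gamma> (\<alpha> i) (\<alpha> j) (\<alpha> k) (\<beta> 1)" and u: "u \<in> linkage_system \<Gamma>"
    and co: "(u $ \<alpha> i, u $ \<alpha> j, u $ \<alpha> k, u $ \<beta> 1) = (0, 0, 1, 0)"
  defines "g \<equiv> (\<lambda>m. octet \<Gamma> (\<alpha> i) (\<alpha> j) (\<alpha> k) (\<beta> 1) u ! (m - 1))"
  shows "loctet_family \<Gamma> \<alpha> \<beta> i j k g" "g ` {1..8} = set (octet \<Gamma> (\<alpha> i) (\<alpha> j) (\<alpha> k) (\<beta> 1) u)"
proof -
  interpret claw \<Gamma> "\<alpha> i" "\<alpha> j" "\<alpha> k" "\<beta> 1" by (rule cl)
  have "loctet_relations \<Gamma> \<alpha> \<beta> i j k g"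
    using u by (simp add: loctet_relations_def g_def octet_def Let_def del: One_nat_def)
  moreover have "\<forall>m\<in>{1..8}. g m \<in> linkage_system \<Gamma>"
    using u by (simp add: atLeastAtMost_1_8 g_def octet_def Let_def del: One_nat_def)
  ultimately show "loctet_family \<Gamma> \<alpha> \<beta> i j k g"
    using co by (simp add: loctet_family_def g_def octet_def Let_def del: One_nat_def)
  show "g ` {1..8} = set (octet \<Gamma> (\<alpha> i) (\<alpha> j) (\<alpha> k) (\<beta> 1) u)"
    unfolding atLeastAtMost_1_8 by (simp add: g_def octet_def Let_def)
qed

text \<open>Reduces a loctet to two data, its type and its member number 8.\<close>

lemma loctet_iff_octet:
  assumes cl: "\<And>i j k. {i, j, k} = {1, 2, 3} \<Longrightarrow> claw \<Gamma> (\<alpha> i) (\<alpha> j) (\<alpha> k) (\<beta> 1)"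
  shows "loctet \<Gamma> \<alpha> \<beta> S \<longleftrightarrow>
    (\<exists>i j k u. {i, j, k} = {1, 2, 3} \<and> i < j \<and> u \<in> linkage_system \<Gamma> \<and>
       (u $ \<alpha> i, u $ \<alpha> j, u $ \<alpha> k, u $ \<beta> 1) = (0, 0, 1, 0) \<and>
       S = set (octet \<Gamma> (\<alpha> i) (\<alpha> j) (\<alpha> k) (\<beta> 1) u))" (is "_ \<longleftrightarrow> ?R")
proof
  assume "loctet \<Gamma> \<alpha> \<beta> S"
  then obtain i j k g where "{i, j, k} = {1, 2, 3}" "i < j" "loctet_family \<Gamma> \<alpha> \<beta> i j k g"
    "S = g ` {1..8}"
    unfolding loctet_def loctet_of_type_def by blast
  then show ?R using loctet_family_octet[where \<alpha> = \<alpha> and \<beta> = \<beta>, OF cl] by metis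
next
  assume ?R
  then obtain i j k u where "{i, j, k} = {1, 2, 3}" "i < j" "u \<in> linkage_system \<Gamma>"
    "(u $ \<alpha> i, u $ \<alpha> j, u $ \<alpha> k, u $ \<beta> 1) = (0, 0, 1, 0)"
    "S = set (octet \<Gamma> (\<alpha> i) (\<alpha> j) (\<alpha> k) (\<beta> 1) u)"
    by blast
  then show "loctet \<Gamma> \<alpha> \<beta> S"
    unfolding loctet_def loctet_of_type_def
    using octet_loctet_family[where \<alpha> = \<alpha> and \<beta> = \<beta>, OF cl] by metis
qed

section \<open>Uniqueness and existence of the loctet through a linkage diagram\<close>

lemma triple_eq_123:
  assumes "{i, j, k} = {1, 2, 3::nat}"
  shows "i \<in> {1, 2, 3}" "j \<in> {1, 2, 3}" "k \<in> {1, 2, 3}" "i \<noteq> j" "i \<noteq> k" "j \<noteq> k"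
proof -
  show "i \<in> {1, 2, 3}" "j \<in> {1, 2, 3}" "k \<in> {1, 2, 3}"
    unfolding assms[symmetric] by simp_all
  have "card {i, j, k} = 3" unfolding assms by simp
  then show "i \<noteq> j" "i \<noteq> k" "j \<noteq> k"
    by (auto simp: card_insert_if split: if_splits)
qed

lemma ordered_triple_cases:
  assumes "{i, j, k} = {1, 2, 3::nat}" "i < j"
  shows "(i, j, k) \<in> {(1, 2, 3), (1, 3, 2), (2, 3, 1)}"
  using triple_eq_123[OF assms(1)] assms(2) by (elim insertE emptyE) simp_all

text \<open>Both data are recovered from the member \<open>v\<close> alone: the type from the
  absolute values of its leaf labels, number 8 by \<open>octet_top\<close>.\<close>

lemma loctet_unique:
  assumes cl: "\<And>i j k. {i, j, k} = {1, 2, 3} \<Longrightarrow> claw \<Gamma> (\<alpha> i) (\<alpha> j) (\<alpha> k) (\<beta> 1)"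
    and S: "loctet \<Gamma> \<alpha> \<beta> S" "v \<in> S" and T: "loctet \<Gamma> \<alpha> \<beta> T" "v \<in> T"
  shows "S = T"
proof -
  let ?O = "\<lambda>(i, j, k). octet \<Gamma> (\<alpha> i) (\<alpha> j) (\<alpha> k) (\<beta> 1)"
  let ?top = "\<lambda>(i, j, k). octet_top \<Gamma> (\<alpha> i) (\<alpha> j) (\<alpha> k) (\<beta> 1) v"
  define kind where "kind x \<longleftrightarrow> x \<in> {(1, 2, 3), (1, 3, 2), (2, 3, 1)} \<and>
    (case x of (i, j, k) \<Rightarrow> \<bar>v $ \<alpha> i\<bar> = \<bar>v $ \<alpha> j\<bar> \<and> \<bar>v $ \<alpha> k\<bar> \<noteq> \<bar>v $ \<alpha> i\<bar>)" for x
  have *: "\<exists>x. kind x \<and> X = set (?O x (?top x))" if X: "loctet \<Gamma> \<alpha> \<beta> X" "v \<in> X" for X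
  proof -
    obtain i j k u where ijk: "{i, j, k} = {1, 2, 3}" "i < j" and u: "u \<in> linkage_system \<Gamma>"
      "(u $ \<alpha> i, u $ \<alpha> j, u $ \<alpha> k, u $ \<beta> 1) = (0, 0, 1, 0)" and X_def: "X = set (?O (i, j, k) u)"
      using loctet_iff_octet[where \<alpha> = \<alpha> and \<beta> = \<beta>, OF cl, THEN iffD1, OF _ X(1)]
      unfolding prod.case by blast
    interpret claw \<Gamma> "\<alpha> i" "\<alpha> j" "\<alpha> k" "\<beta> 1" by (rule cl[OF ijk(1)])
    have "kind (i, j, k)" using ordered_triple_cases[OF ijk] octet_type[OF u(2)] X(2) X_def
      unfolding kind_def by simp
    moreover have "?top (i, j, k) = u" using octet_top_octet[OF _ u(2)] u(1) X(2) X_def by simp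
    ultimately show ?thesis using X_def by blast
  qed
  obtain x y where x: "kind x" "S = set (?O x (?top x))" and y: "kind y" "T = set (?O y (?top y))"
    using *[OF S] *[OF T] by blast
  \<comment> \<open>Two different types would equate absolute values that each of them requires to
    differ.\<close>
  have "x = y"
    using x(1) y(1) unfolding kind_def by (elim conjE insertE emptyE) simp_all
  then show ?thesis by (simp only: x(2) y(2))
qed

lemma loctet_exists:
  assumes cl: "\<And>i j k. {i, j, k} = {1, 2, 3} \<Longrightarrow> claw \<Gamma> (\<alpha> i) (\<alpha> j) (\<alpha> k) (\<beta> 1)"
    and v: "v \<in> linkage_system \<Gamma>" and nz: "\<not> beta_unicolored \<alpha> v"
  shows "\<exists>S. loctet \<Gamma> \<alpha> \<beta> S \<and> v \<in> S"
proof -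
  have "v $ \<alpha> 1 \<noteq> 0 \<or> v $ \<alpha> 2 \<noteq> 0 \<or> v $ \<alpha> 3 \<noteq> 0"
    using nz unfolding beta_unicolored_def alpha_labels_def by blast
  note types = claw.type_cases[OF cl[OF refl] v this]
  have perm: "{1, 3, 2} = {1, 2, 3::nat}" "{2, 3, 1} = {1, 2, 3::nat}"
    by (simp_all add: insert_commute)
  \<comment> \<open>The leaf whose label stands out in absolute value becomes
    \<open>k\<close>.\<close>
  obtain i j k where ijk: "{i, j, k} = {1, 2, 3}" "i < j"
    and kind: "\<bar>v $ \<alpha> i\<bar> = \<bar>v $ \<alpha> j\<bar>" "\<bar>v $ \<alpha> k\<bar> \<noteq> \<bar>v $ \<alpha> i\<bar>"
    using types that[OF refl] that[OF perm(1)] that[OF perm(2)] by linarith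
  interpret claw \<Gamma> "\<alpha> i" "\<alpha> j" "\<alpha> k" "\<beta> 1" by (rule cl[OF ijk(1)])
  show ?thesis
    using octet_top_works[OF v kind] ijk loctet_iff_octet[where \<alpha> = \<alpha> and \<beta> = \<beta>, OF cl] by blast
qed

text \<open>Labels with different absolute values, at \<open>\<alpha> i\<close> and
  \<open>\<alpha> k\<close>, cannot both vanish.\<close>

lemma loctet_not_unicolored:
  assumes cl: "\<And>i j k. {i, j, k} = {1, 2, 3} \<Longrightarrow> claw \<Gamma> (\<alpha> i) (\<alpha> j) (\<alpha> k) (\<beta> 1)"
    and S: "loctet \<Gamma> \<alpha> \<beta> S" "v \<in> S"
  shows "\<not> beta_unicolored \<alpha> v"
proof -
  obtain i j k u where ijk: "{i, j, k} = {1, 2, 3}"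
    and u: "(u $ \<alpha> i, u $ \<alpha> j, u $ \<alpha> k, u $ \<beta> 1) = (0, 0, 1, 0)"
    and v: "v \<in> set (octet \<Gamma> (\<alpha> i) (\<alpha> j) (\<alpha> k) (\<beta> 1) u)"
    using loctet_iff_octet[where \<alpha> = \<alpha> and \<beta> = \<beta>, OF cl, THEN iffD1, OF _ S(1)] S(2)
    by blast
  interpret claw \<Gamma> "\<alpha> i" "\<alpha> j" "\<alpha> k" "\<beta> 1" by (rule cl[OF ijk])
  have "v $ \<alpha> k \<noteq> 0 \<or> v $ \<alpha> i \<noteq> 0" using octet_type(2)[OF u v] by auto
  moreover have "i \<in> {1, 2, 3}" "k \<in> {1, 2, 3}" using triple_eq_123[OF ijk] by simp_all
  ultimately show ?thesis unfolding beta_unicolored_def alpha_labels_def by blast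
qed

text \<open>The leaves are pairwise unbonded because they belong to the \<open>\<alpha>\<close>-set;
  the solid edges at \<open>\<beta> 1\<close> are symmetric in the three leaves, so every order of
  them is allowed.\<close>

lemma predefined_numbering_claw:
  assumes "diagram_wf \<Gamma>" and num: "predefined_numbering \<Gamma> k h \<alpha> \<beta>"
    and ijk: "{p, q, r} = {1, 2, 3::nat}"
  shows "claw \<Gamma> (\<alpha> p) (\<alpha> q) (\<alpha> r) (\<beta> 1)"
proof -
  have split: "alpha_beta_split \<Gamma> k h \<alpha> \<beta>" and kh: "k \<ge> 3" "h \<ge> 1"
    and solid: "\<forall>i\<in>{1, 2, 3}. bond_of \<Gamma> (\<beta> 1) (\<alpha> i) = Solid"
    using num unfolding predefined_numbering_def by blast+
  note ran = triple_eq_123(1-3)[OF ijk] and dist = triple_eq_123(4-6)[OF ijk]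
  have "i \<in> {1..k}" if "i \<in> {1, 2, 3}" for i using that kh by auto
  then have mem: "p \<in> {1..k}" "q \<in> {1..k}" "r \<in> {1..k}" using ran by blast+
  have cover: "\<alpha> ` {1..k} \<union> \<beta> ` {1..h} = {..<size_of \<Gamma>}"
    using split by (simp add: alpha_beta_split_def)
  have less: "\<alpha> i < size_of \<Gamma>" if "i \<in> {1..k}" for i using cover that by blast
  have "\<beta> 1 < size_of \<Gamma>" using cover kh(2) by force
  moreover have "bond_of \<Gamma> (\<alpha> i) (\<alpha> j) = No_Edge" if "i \<in> {1..k}" "j \<in> {1..k}" for i j
    using split that less by (auto simp: alpha_beta_split_def adj_def)
  moreover have "inj_on \<alpha> {1..k}" using split by (simp add: alpha_beta_split_def)
  ultimately show ?thesis
    using assms(1) mem dist less solid ran by unfold_locales (auto dest: inj_onD)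
qed

theorem corollary2p16:
  fixes \<Gamma> :: diagram and k h :: nat and \<alpha> \<beta> :: "nat \<Rightarrow> nat"
  assumes "carter_diagram \<Gamma>"
    and "class_C4 \<Gamma> \<or> class_DE4 \<Gamma>"
    and "predefined_numbering \<Gamma> k h \<alpha> \<beta>"
  shows "(\<forall>v\<in>linkage_system \<Gamma>. (\<exists>a\<in>alpha_labels \<alpha> v. a \<noteq> 0) \<longrightarrow> (\<exists>S. loctet \<Gamma> \<alpha> \<beta> S \<and> v \<in> S)) \<and>
    (\<forall>S v. loctet \<Gamma> \<alpha> \<beta> S \<and> v \<in> S \<longrightarrow> (\<exists>!T. loctet \<Gamma> \<alpha> \<beta> T \<and> v \<in> T)) \<and>
    (\<forall>S T. loctet \<Gamma> \<alpha> \<beta> S \<and> loctet \<Gamma> \<alpha> \<beta> T \<and> S \<inter> T \<noteq> {} \<longrightarrow> S = T) \<and>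
    (\<forall>v\<in>linkage_system \<Gamma>. (\<exists>S. loctet \<Gamma> \<alpha> \<beta> S \<and> v \<in> S) \<noteq> beta_unicolored \<alpha> v)"
proof -
  have "diagram_wf \<Gamma>" using assms(1) by (simp add: carter_diagram_def)
  note cl = predefined_numbering_claw[OF this assms(3)]
  \<comment> \<open>This equivalence yields the first and the fourth claim, the latter as an
    exclusive alternative.\<close>
  have "(\<exists>S. loctet \<Gamma> \<alpha> \<beta> S \<and> v \<in> S) \<longleftrightarrow> \<not> beta_unicolored \<alpha> v" if "v \<in> linkage_system \<Gamma>" for v
    using loctet_exists[where \<alpha> = \<alpha> and \<beta> = \<beta>, OF cl that]
      loctet_not_unicolored[where \<alpha> = \<alpha> and \<beta> = \<beta>, OF cl] by blast
  \<comment> \<open>Uniqueness through a common member yields the second and the third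
    claim.\<close>
  moreover have "S = T" if "loctet \<Gamma> \<alpha> \<beta> S" "v \<in> S" "loctet \<Gamma> \<alpha> \<beta> T" "v \<in> T" for S T v
    using loctet_unique[where \<alpha> = \<alpha> and \<beta> = \<beta>, OF cl that] .
  ultimately show ?thesis unfolding beta_unicolored_def by blast
qed

end
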